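(* Let $S_1,S_2\subset\mathbb{R}^{N+1}$ be the graphs of $f_1(u_1,\mathbf{v}_1)$ and $f_2(u_2,\mathbf{v}_2)$ and let $F$, $G$, $\Delta$ be as defined in the context. Let $(u_1,\mathbf{v}_1,u_2,\mathbf{v}_2,X)$ be a point with $G(u_1,\mathbf{v}_1,u_2,\mathbf{v}_2,X)=\mathbf{0}$, so that $X$ is a point of the EMH. If $\Delta\neq 0$ at this point, then the EMH is smooth at the point $X$.
   Context: $S_1,S_2$ are non-degenerate locally convex hypersurfaces in $\mathbb{R}^{N+1}$, with every tangent space of $S_1$ transversal to every tangent space of $S_2$. $S_i$ is the graph of a smooth function $f_i(u_i,\mathbf{v}_i)$, $\mathbf{v}_i=(v_{i,1},\dots,v_{i,N-1})$, i.e. its points are $p_i=(u_i,\mathbf{v}_i,f_i(u_i,\mathbf{v}_i))$. Let $$N_i=\left(-(f_i)_{u_i},-(f_i)_{v_{i,1}},\dots,-(f_i)_{v_{i,N-1}},1\right),\quad M=\tfrac{p_1+p_2}{2},\quad C=\tfrac{p_1-p_2}{2},$$ $$F(p_1,p_2,X)=\big((N_1\cdot C)N_2+(N_2\cdot C)N_1\big)\cdot(X-M),\qquad X\in\mathbb{R}^{N+1},$$ with $\cdot$ the canonical inner product; $F$ is regarded as a function of $(u_1,\mathbf{v}_1,u_2,\mathbf{v}_2,X)$. For fixed $(p_1,p_2)$, $F=0$ is the equation of the mid-hyperplane of $(p_1,p_2)$, i.e. the hyperplane through $M$ and the intersection of the affine tangent spaces at $p_1,p_2$; the mid-hyperplane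 is assumed to be non-degenerate, i.e. $(N_1\cdot C)N_2+(N_2\cdot C)N_1\ne 0$. Define $G:\mathbb{R}^{2N}\times\mathbb{R}^{N+1}\to\mathbb{R}^{2N+1}$ (on the domain where the $f_i$ are defined) by $G=(F,F_{u_1},F_{\mathbf{v}_1},F_{u_2},F_{\mathbf{v}_2})$, where subscripts denote partial derivatives. The Envelope of Mid-Hyperplanes (EMH) is $\pi_2(G^{-1}(\mathbf{0}))$, where $\pi_2(u_1,\mathbf{v}_1,u_2,\mathbf{v}_2,X)=X$. $\Delta$ is the determinant of the $2N\times 2N$ matrix of second partial derivatives of $F$ with respect to the parameters $(u_1,\mathbf{v}_1,u_2,\mathbf{v}_2)$ (with $X$ fixed), evaluated at the point. "The EMH is smooth at $X$" means that near the given point $G^{-1}(\mathbf{0})$ is an $N$-dimensional submanifold of $\mathbb{R}^{3N+1}$ and that $\pi_2$ maps a neighbourhood of the point in it diffeomorphically onto a smooth hypersurface of $\mathbb{R}^{N+1}$ through $X$. *)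

theory Defs
  imports "HOL-Analysis.Analysis"
begin

section \<open>Smooth maps, submanifolds and diffeomorphisms in Euclidean spaces\<close>

(* Meant for open S: C^k in the sense that all iterated directional derivatives up to
   order k exist as Frechet derivatives and are continuous. *)
primrec Ck_on :: "nat \<Rightarrow> 'a::euclidean_space set \<Rightarrow> ('a \<Rightarrow> 'b::euclidean_space) \<Rightarrow> bool" where
  "Ck_on 0 S f \<longleftrightarrow> continuous_on S f"
| "Ck_on (Suc k) S f \<longleftrightarrow>
     (\<forall>x\<in>S. f differentiable (at x)) \<and> (\<forall>v. Ck_on k S (\<lambda>x. frechet_derivative f (at x) v))"

definition smooth_on :: "'a::euclidean_space set \<Rightarrow> ('a \<Rightarrow> 'b::euclidean_space) \<Rightarrow> bool" where
  "smooth_on S f \<longleftrightarrow> (\<forall>k. Ck_on k S f)"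

(* On an arbitrary subset M, a map is smooth if it extends locally to smooth maps on open sets. *)
definition smooth_map :: "'a::euclidean_space set \<Rightarrow> ('a \<Rightarrow> 'b::euclidean_space) \<Rightarrow> bool" where
  "smooth_map M f \<longleftrightarrow>
     (\<forall>x\<in>M. \<exists>W g. open W \<and> x \<in> W \<and> smooth_on W g \<and> (\<forall>y\<in>W \<inter> M. g y = f y))"

definition diffeomorphism ::
    "'a::euclidean_space set \<Rightarrow> 'b::euclidean_space set \<Rightarrow> ('a \<Rightarrow> 'b) \<Rightarrow> bool" where
  "diffeomorphism M M' f \<longleftrightarrow>
     bij_betw f M M' \<and> smooth_map M f \<and> smooth_map M' (inv_into M f)"

(* Embedded k-dimensional submanifolds, via slice charts of the ambient space. *)
definition smooth_submanifold :: "nat \<Rightarrow> 'a::euclidean_space set \<Rightarrow> bool" where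
  "smooth_submanifold k M \<longleftrightarrow>
     (\<forall>x\<in>M. \<exists>W V \<phi> (L :: 'a set).
        open W \<and> x \<in> W \<and> open V \<and> diffeomorphism W V \<phi> \<and>
        subspace L \<and> dim L = k \<and> \<phi> ` (W \<inter> M) = V \<inter> L)"

definition partial_deriv :: "'a::euclidean_space \<Rightarrow> ('a \<Rightarrow> real) \<Rightarrow> 'a \<Rightarrow> real" where
  "partial_deriv b f x = deriv (\<lambda>t. f (x + t *\<^sub>R b)) 0"


section \<open>Hypersurfaces given as graphs\<close>

(* N = CARD('n). The parameters (u, v_1, ..., v_(N-1)) of one hypersurface form a single
   vector of real^'n, and R^(N+1) is (real^'n) * real, whose inner product is the
   canonical one. *)

definition graph_point :: "(real^'n \<Rightarrow> real) \<Rightarrow> real^'n \<Rightarrow> (real^'n) \<times> real" where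
  "graph_point f x = (x, f x)"

definition graph_normal :: "(real^'n \<Rightarrow> real) \<Rightarrow> real^'n \<Rightarrow> (real^'n) \<times> real" where
  "graph_normal f x = ((\<chi> i. - partial_deriv (axis i 1) f x), 1)"

(* The tangent space as a linear subspace (directions). *)
definition graph_tangent_space :: "(real^'n \<Rightarrow> real) \<Rightarrow> real^'n \<Rightarrow> ((real^'n) \<times> real) set" where
  "graph_tangent_space f x = range (\<lambda>h. (h, frechet_derivative f (at x) h))"

definition transversal :: "'a::real_vector set \<Rightarrow> 'a set \<Rightarrow> bool" where
  "transversal T T' \<longleftrightarrow> {a + b | a b. a \<in> T \<and> b \<in> T'} = UNIV"

(* The second fundamental form of a graph is, up to a positive factor, the Hessian of f. *)
definition nondegenerate_graph :: "(real^'n) set \<Rightarrow> (real^'n \<Rightarrow> real) \<Rightarrow> bool" where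
  "nondegenerate_graph U f \<longleftrightarrow>
     (\<forall>x\<in>U. det ((\<chi> i j. partial_deriv (axis i 1) (partial_deriv (axis j 1) f) x)
                   :: real^'n^'n) \<noteq> 0)"

(* Each point p of the hypersurface has a neighbourhood in it that lies in one of the closed
   half-spaces bounded by the affine tangent hyperplane at p. *)
definition locally_convex_graph :: "(real^'n) set \<Rightarrow> (real^'n \<Rightarrow> real) \<Rightarrow> bool" where
  "locally_convex_graph U f \<longleftrightarrow>
     (\<forall>x\<in>U. \<exists>W. open W \<and> graph_point f x \<in> W \<and>
        ((\<forall>q \<in> W \<inter> graph_point f ` U. graph_normal f x \<bullet> (q - graph_point f x) \<ge> 0) \<or>
         (\<forall>q \<in> W \<inter> graph_point f ` U. graph_normal f x \<bullet> (q - graph_point f x) \<le> 0)))"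


section \<open>The envelope of mid-hyperplanes\<close>

(* (N_1 . C) N_2 + (N_2 . C) N_1 with C = (p_1 - p_2) / 2 *)
fun mid_normal ::
    "(real^'n \<Rightarrow> real) \<Rightarrow> (real^'n \<Rightarrow> real) \<Rightarrow> (real^'n) \<times> (real^'n) \<Rightarrow> (real^'n) \<times> real" where
  "mid_normal f1 f2 (x1, x2) =
     (let N1 = graph_normal f1 x1; N2 = graph_normal f2 x2;
          C = (graph_point f1 x1 - graph_point f2 x2) /\<^sub>R 2
      in (N1 \<bullet> C) *\<^sub>R N2 + (N2 \<bullet> C) *\<^sub>R N1)"

fun mid_point ::
    "(real^'n \<Rightarrow> real) \<Rightarrow> (real^'n \<Rightarrow> real) \<Rightarrow> (real^'n) \<times> (real^'n) \<Rightarrow> (real^'n) \<times> real" where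
  "mid_point f1 f2 (x1, x2) = (graph_point f1 x1 + graph_point f2 x2) /\<^sub>R 2"

definition emh_F ::
    "(real^'n \<Rightarrow> real) \<Rightarrow> (real^'n \<Rightarrow> real) \<Rightarrow> (real^'n) \<times> (real^'n) \<Rightarrow> (real^'n) \<times> real \<Rightarrow> real" where
  "emh_F f1 f2 w X = mid_normal f1 f2 w \<bullet> (X - mid_point f1 f2 w)"

(* The 2N coordinate directions of the parameter space, indexed by 'n + 'n: Inl for the
   parameters (u_1, v_1) of the first hypersurface, Inr for (u_2, v_2). *)
fun param_axis :: "'n + 'n \<Rightarrow> (real^'n) \<times> (real^'n)" where
  "param_axis (Inl i) = (axis i 1, 0)"
| "param_axis (Inr i) = (0, axis i 1)"

fun emh_G ::
    "(real^'n \<Rightarrow> real) \<Rightarrow> (real^'n \<Rightarrow> real) \<Rightarrow>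
     ((real^'n) \<times> (real^'n)) \<times> ((real^'n) \<times> real) \<Rightarrow> real \<times> (real^('n + 'n))" where
  "emh_G f1 f2 (w, X) =
     (emh_F f1 f2 w X, \<chi> a. partial_deriv (param_axis a) (\<lambda>w'. emh_F f1 f2 w' X) w)"

definition emh_Delta ::
    "(real^'n \<Rightarrow> real) \<Rightarrow> (real^'n \<Rightarrow> real) \<Rightarrow> (real^'n) \<times> (real^'n) \<Rightarrow> (real^'n) \<times> real \<Rightarrow> real" where
  "emh_Delta f1 f2 w X =
     det ((\<chi> a b. partial_deriv (param_axis a)
                    (partial_deriv (param_axis b) (\<lambda>w'. emh_F f1 f2 w' X)) w)
          :: real^('n + 'n)^('n + 'n))"

(* G^(-1)(0), where G is considered on the domain U1 * U2 * R^(N+1) *)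
definition emh_zero_set ::
    "(real^'n) set \<Rightarrow> (real^'n) set \<Rightarrow> (real^'n \<Rightarrow> real) \<Rightarrow> (real^'n \<Rightarrow> real) \<Rightarrow>
     (((real^'n) \<times> (real^'n)) \<times> ((real^'n) \<times> real)) set" where
  "emh_zero_set U1 U2 f1 f2 = {z \<in> (U1 \<times> U2) \<times> UNIV. emh_G f1 f2 z = 0}"

definition EMH ::
    "(real^'n) set \<Rightarrow> (real^'n) set \<Rightarrow> (real^'n \<Rightarrow> real) \<Rightarrow> (real^'n \<Rightarrow> real) \<Rightarrow>
     ((real^'n) \<times> real) set" where
  "EMH U1 U2 f1 f2 = snd ` emh_zero_set U1 U2 f1 f2"

(* Smoothness of the EMH at X = snd z. This is local at the point z of G^(-1)(0) lying over X:
   other sheets of the EMH may pass through X. *)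
definition EMH_smooth_at ::
    "(real^'n) set \<Rightarrow> (real^'n) set \<Rightarrow> (real^'n \<Rightarrow> real) \<Rightarrow> (real^'n \<Rightarrow> real) \<Rightarrow>
     ((real^'n) \<times> (real^'n)) \<times> ((real^'n) \<times> real) \<Rightarrow> bool" where
  "EMH_smooth_at U1 U2 f1 f2 z \<longleftrightarrow>
     (\<exists>W H. open W \<and> z \<in> W \<and>
        smooth_submanifold CARD('n) (W \<inter> emh_zero_set U1 U2 f1 f2) \<and>
        smooth_submanifold CARD('n) H \<and> snd z \<in> H \<and>
        diffeomorphism (W \<inter> emh_zero_set U1 U2 f1 f2) H snd)"

end

theory Submission
  imports Defs
begin

text \<open>
  Write $F(w, X)$ for the family of affine functions of $X$ whose zero sets are the mid-hyperplanes,
  with parameter $w = (x_1, x_2)$, and $K = \<nabla>_w F$ for its gradient in the parameters, so that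
  the zero set of $G$ is $\{F = 0, K = 0\}$. At the given point the parameter derivative of $K$ is
  the Hessian of determinant $\<Delta> \<noteq> 0$, the parameter derivative of $F$ vanishes, and the
  $X$-derivative of $F$ is the inner product with the mid-normal $m \<noteq> 0$. This
  makes the result an instance of a statement on regular envelopes (\<open>smooth_envelope\<close>).

  For the latter, choose $e$ with $m \<bullet> e = 1$ and put
  $\<Phi>(w, X) = (K(w, X), X + (F(w, X) - m \<bullet> X) e)$. The correction term along $e$ is such that
  $m$ pairs with the second component to $F$, hence $\<Phi>$ carries $\{F = 0, K = 0\}$ to the
  linear space $0 \<times> m^\<bottom>$; and its derivative at the point is $(a, x) \<mapsto> (DK(a, x), x)$, which
  is invertible. So $\<Phi>$ is a slice chart for the zero set. The map
  $\<sigma>(Y) = \mathrm{pr}_2\, \<Phi>^{-1}(0, Y)$ has the identity as derivative, so it is a local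
  diffeomorphism as well, and it parametrises the projection of the zero set by an open
  piece of $m^\<bottom>$. Thus the projection is a smooth hypersurface $H$, and
  $X \<mapsto> \<Phi>^{-1}(0, \<sigma>^{-1}(X))$ is a smooth inverse of the projection onto it.

  The analytic input is the inverse function theorem with smooth inverse
  (\<open>smooth_inverse_function\<close>). It comes from the differentiable version by
  bootstrapping: the derivative of the inverse is the pointwise inverse of a family of linear maps,
  and inverting such a family preserves the class $C^k$ (\<open>Ck_on_linear_inverse\<close>).
\<close>


section \<open>Calculus of maps of class $C^k$\<close>

lemma Ck_on_cong:
  assumes "open S" "\<And>x. x \<in> S \<Longrightarrow> f x = g x"
  shows "Ck_on k S f \<longleftrightarrow> Ck_on k S g"
  using assms(2)
proof (induction k arbitrary: f g)
  case 0
  then show ?case using continuous_on_cong[of S S f g] by simp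
next
  case (Suc k)
  have dfg: "(f has_derivative D) (at x) \<longleftrightarrow> (g has_derivative D) (at x)" if "x \<in> S" for x D
  proof
    show "(g has_derivative D) (at x)" if "(f has_derivative D) (at x)"
      by (rule has_derivative_transform_within_open[OF that assms(1) \<open>x \<in> S\<close> Suc.prems])
    show "(f has_derivative D) (at x)" if "(g has_derivative D) (at x)"
      by (rule has_derivative_transform_within_open[OF that assms(1) \<open>x \<in> S\<close> Suc.prems[symmetric]])
  qed
  have "(f differentiable at x) = (g differentiable at x)" if "x \<in> S" for x
    by (simp add: differentiable_def dfg[OF that])
  moreover have "frechet_derivative f (at x) = frechet_derivative g (at x)" if "x \<in> S" for x
    by (simp add: frechet_derivative_def dfg[OF that])
  then have "Ck_on k S (\<lambda>x. frechet_derivative f (at x) v)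
      = Ck_on k S (\<lambda>x. frechet_derivative g (at x) v)" for v
    by (intro Suc.IH) simp
  ultimately show ?case by simp
qed

text \<open>
  The recursion in the definition runs over the derivative chosen by \<^const>\<open>frechet_derivative\<close>;
  this rule allows any explicit formula for the derivative instead, which is the form
  in which product and chain rule deliver it.
\<close>
lemma Ck_on_SucI:
  assumes "open S" "\<And>x. x \<in> S \<Longrightarrow> (f has_derivative f' x) (at x)"
    and "\<And>v. Ck_on k S (\<lambda>x. f' x v)"
  shows "Ck_on (Suc k) S f"
proof -
  have "frechet_derivative f (at x) = f' x" if "x \<in> S" for x
    using assms(2)[OF that] by (rule frechet_derivative_at[symmetric])
  then have "Ck_on k S (\<lambda>x. frechet_derivative f (at x) v) = Ck_on k S (\<lambda>x. f' x v)" for v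
    by (intro Ck_on_cong assms(1)) simp
  with assms(3) show ?thesis
    by (simp add: differentiableI[OF assms(2)])
qed

lemma Ck_on_Suc_has_derivative:
  assumes "Ck_on (Suc k) S f" "x \<in> S"
  shows "(f has_derivative frechet_derivative f (at x)) (at x)"
  using assms by (simp add: frechet_derivative_works)

lemma Ck_on_SucD: "Ck_on (Suc k) S f \<Longrightarrow> Ck_on k S f"
proof (induction k arbitrary: f)
  case 0
  then show ?case
    by (auto intro!: continuous_at_imp_continuous_on differentiable_imp_continuous_within)
next
  case (Suc k)
  have "\<forall>x\<in>S. f differentiable at x"
    and "\<And>v. Ck_on (Suc k) S (\<lambda>x. frechet_derivative f (at x) v)"
    using Suc.prems Ck_on.simps(2)[of "Suc k" S f] by blast+
  then show ?case
    unfolding Ck_on.simps(2)[of k S f] by (intro conjI allI Suc.IH)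
qed

lemma Ck_on_subset: "Ck_on k S f \<Longrightarrow> T \<subseteq> S \<Longrightarrow> Ck_on k T f"
  by (induction k arbitrary: f) (auto intro: continuous_on_subset)

lemma Ck_on_const: "open S \<Longrightarrow> Ck_on k S (\<lambda>x. c)"
proof (induction k arbitrary: c)
  case (Suc k)
  show ?case by (rule Ck_on_SucI[OF Suc.prems has_derivative_const]) (rule Suc.IH[OF Suc.prems])
qed simp

lemma Ck_on_linear:
  assumes "open S" "bounded_linear f"
  shows "Ck_on k S f"
proof (cases k)
  case 0
  then show ?thesis
    using assms by (simp add: linear_continuous_on)
next
  case (Suc j)
  show ?thesis
    unfolding Suc
    by (rule Ck_on_SucI[OF assms(1) bounded_linear_imp_has_derivative[OF assms(2)]])
      (rule Ck_on_const[OF assms(1)])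
qed

lemma Ck_on_add: "open S \<Longrightarrow> Ck_on k S f \<Longrightarrow> Ck_on k S g \<Longrightarrow> Ck_on k S (\<lambda>x. f x + g x)"
proof (induction k arbitrary: f g)
  case 0
  then show ?case by (simp add: continuous_on_add)
next
  case (Suc k)
  show ?case
  proof (rule Ck_on_SucI[OF Suc.prems(1)])
    show "((\<lambda>x. f x + g x) has_derivative
        (\<lambda>v. frechet_derivative f (at x) v + frechet_derivative g (at x) v)) (at x)" if "x \<in> S" for x
      by (rule has_derivative_add[OF Suc.prems(2,3)[THEN Ck_on_Suc_has_derivative, OF that]])
    show "Ck_on k S (\<lambda>x. frechet_derivative f (at x) v + frechet_derivative g (at x) v)" for v
      using Suc.prems by (intro Suc.IH) simp_all
  qed
qed

lemma Ck_on_sum: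
  assumes "open S" "\<And>i. i \<in> I \<Longrightarrow> Ck_on k S (f i)"
  shows "Ck_on k S (\<lambda>x. \<Sum>i\<in>I. f i x)"
  using assms(2)
  by (induction I rule: infinite_finite_induct) (auto intro: Ck_on_const Ck_on_add assms(1))

lemma Ck_on_bilinear:
  assumes "open S" "bounded_bilinear B"
  shows "Ck_on k S f \<Longrightarrow> Ck_on k S g \<Longrightarrow> Ck_on k S (\<lambda>x. B (f x) (g x))"
proof (induction k arbitrary: f g)
  case 0
  then show ?case by (simp add: bounded_bilinear.continuous_on[OF assms(2)])
next
  case (Suc k)
  show ?case
  proof (rule Ck_on_SucI[OF assms(1)])
    show "((\<lambda>x. B (f x) (g x)) has_derivative (\<lambda>v. B (f x) (frechet_derivative g (at x) v)
        + B (frechet_derivative f (at x) v) (g x))) (at x)" if "x \<in> S" for x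
      by (rule bounded_bilinear.FDERIV[OF assms(2) Suc.prems[THEN Ck_on_Suc_has_derivative, OF that]])
    show "Ck_on k S (\<lambda>x. B (f x) (frechet_derivative g (at x) v)
        + B (frechet_derivative f (at x) v) (g x))" for v
      using Suc.prems[THEN Ck_on_SucD] Suc.prems
      by (intro Ck_on_add Suc.IH assms(1)) simp_all
  qed
qed

text \<open>
  Directional derivatives are only known to be $C^k$ for fixed directions. Expanding in a basis
  reduces a derivative in a direction that varies with the point to finitely many fixed ones.
\<close>
lemma linear_Basis_expansion:
  fixes f :: "'a::euclidean_space \<Rightarrow> 'b::real_vector"
  assumes "linear f"
  shows "f x = (\<Sum>b\<in>Basis. (x \<bullet> b) *\<^sub>R f b)"
proof -
  have "f x = f (\<Sum>b\<in>Basis. (x \<bullet> b) *\<^sub>R b)"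
    by (simp only: euclidean_representation)
  also have "\<dots> = (\<Sum>b\<in>Basis. f ((x \<bullet> b) *\<^sub>R b))"
    by (rule linear_sum[OF assms])
  finally show ?thesis by (simp only: linear_scale[OF assms])
qed

text \<open>
  By the chain rule, the derivative of the composition in direction $v$ is
  $\sum_b (Df(x)v \<bullet> b)\, Dg(f(x))b$, to which the induction hypothesis on $k$ applies summand by
  summand.
\<close>
lemma Ck_on_compose:
  fixes f :: "'a::euclidean_space \<Rightarrow> 'b::euclidean_space"
  assumes "open S" "open T" "f ` S \<subseteq> T"
  shows "Ck_on k T g \<Longrightarrow> Ck_on k S f \<Longrightarrow> Ck_on k S (\<lambda>x. g (f x))"
proof (induction k arbitrary: g)
  case 0
  then show ?case using continuous_on_compose2[of T g S f] assms(3) by simp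
next
  case (Suc k)
  let ?Dg = "\<lambda>x. frechet_derivative g (at x)" and ?Df = "\<lambda>x. frechet_derivative f (at x)"
  show ?case
  proof (rule Ck_on_SucI[OF assms(1)])
    show "((\<lambda>x. g (f x)) has_derivative (\<lambda>v. \<Sum>b\<in>Basis. (?Df x v \<bullet> b) *\<^sub>R ?Dg (f x) b)) (at x)"
      if "x \<in> S" for x
    proof -
      have g: "(g has_derivative ?Dg (f x)) (at (f x))"
        using that assms(3) by (intro Ck_on_Suc_has_derivative[OF Suc.prems(1)]) auto
      have "((\<lambda>x. g (f x)) has_derivative (\<lambda>v. ?Dg (f x) (?Df x v))) (at x)"
        using diff_chain_at[OF Ck_on_Suc_has_derivative[OF Suc.prems(2) that] g]
        by (simp add: o_def)
      moreover have "(\<lambda>v. ?Dg (f x) (?Df x v)) = (\<lambda>v. \<Sum>b\<in>Basis. (?Df x v \<bullet> b) *\<^sub>R ?Dg (f x) b)"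
        by (rule ext, rule linear_Basis_expansion[OF has_derivative_linear[OF g]])
      ultimately show ?thesis by simp
    qed
    show "Ck_on k S (\<lambda>x. \<Sum>b\<in>Basis. (?Df x v \<bullet> b) *\<^sub>R ?Dg (f x) b)" for v
    proof (intro Ck_on_sum[OF assms(1)] Ck_on_bilinear[OF assms(1) bounded_bilinear_scaleR]
        Ck_on_bilinear[OF assms(1) bounded_bilinear_inner])
      fix b :: 'b
      show "Ck_on k S (\<lambda>x. ?Df x v)" using Suc.prems(2) by simp
      show "Ck_on k S (\<lambda>x. b)" by (rule Ck_on_const[OF assms(1)])
      show "Ck_on k S (\<lambda>x. ?Dg (f x) b)"
        using Suc.prems(1) by (intro Suc.IH Ck_on_SucD[OF Suc.prems(2)]) simp
    qed
  qed
qed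

lemma Ck_on_uminus: "open S \<Longrightarrow> Ck_on k S f \<Longrightarrow> Ck_on k S (\<lambda>x. - f x)"
  by (rule Ck_on_compose[OF _ open_UNIV subset_UNIV
        Ck_on_linear[OF open_UNIV bounded_linear_minus[OF bounded_linear_ident]]])

lemma Ck_on_Pair: "open S \<Longrightarrow> Ck_on k S f \<Longrightarrow> Ck_on k S g \<Longrightarrow> Ck_on k S (\<lambda>x. (f x, g x))"
proof (induction k arbitrary: f g)
  case 0
  then show ?case by (simp add: continuous_on_Pair)
next
  case (Suc k)
  show ?case
  proof (rule Ck_on_SucI[OF Suc.prems(1)])
    show "((\<lambda>x. (f x, g x)) has_derivative
        (\<lambda>v. (frechet_derivative f (at x) v, frechet_derivative g (at x) v))) (at x)" if "x \<in> S" for x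
      by (rule has_derivative_Pair[OF Suc.prems(2,3)[THEN Ck_on_Suc_has_derivative, OF that]])
    show "Ck_on k S (\<lambda>x. (frechet_derivative f (at x) v, frechet_derivative g (at x) v))" for v
      using Suc.prems by (intro Suc.IH) simp_all
  qed
qed

section \<open>Inverting a family of linear maps\<close>

text \<open>
  A product rule in which one factor is merely continuous, at a zero of the other. It gives the
  differentiability of $y \<mapsto> A(y)^{-1}v$ from mere continuity, since
  $A(y)^{-1}v - A(p)^{-1}v$ is $A(y)^{-1}$ applied to a differentiable map that vanishes at $p$.
\<close>
lemma has_derivative_scaleR_vanishing:
  fixes c :: "'a::real_normed_vector \<Rightarrow> real" and h :: "'a \<Rightarrow> 'b::real_normed_vector"
  assumes c: "(c has_derivative c') (at x)" "c x = 0" and h: "isCont h x"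
  shows "((\<lambda>y. c y *\<^sub>R h y) has_derivative (\<lambda>v. c' v *\<^sub>R h x)) (at x)"
proof -
  have lim: "((\<lambda>y. norm (c y - c x - c' (y - x)) / norm (y - x)) \<longlongrightarrow> 0) (at x)"
    using c(1) unfolding has_derivative_iff_norm by blast
  have bl: "bounded_linear c'" using c(1) by (rule has_derivative_bounded_linear)
  then obtain K where K: "\<And>v. norm (c' v) \<le> norm v * K" "K > 0" 
    using bounded_linear.pos_bounded by blast
  have hl: "((\<lambda>y. norm (h y - h x)) \<longlongrightarrow> 0) (at x)"
    using h by (simp add: isCont_def tendsto_norm_zero LIM_zero)
  have lim2: "((\<lambda>y. norm (c y - c x - c' (y - x)) / norm (y - x) * norm (h y)
      + K * norm (h y - h x)) \<longlongrightarrow> 0 * norm (h x) + K * 0) (at x)"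
    using h by (intro tendsto_intros lim hl) (simp add: isCont_def)
  have "((\<lambda>y. norm (c y *\<^sub>R h y - c x *\<^sub>R h x - c' (y - x) *\<^sub>R h x) / norm (y - x)) \<longlongrightarrow> 0) (at x)"
  proof (rule Lim_null_comparison[OF _ lim2[simplified]])
    show "\<forall>\<^sub>F y in at x. norm (norm (c y *\<^sub>R h y - c x *\<^sub>R h x - c' (y - x) *\<^sub>R h x) / norm (y - x))
      \<le> \<bar>c y - c x - c' (y - x)\<bar> * norm (h y) / norm (y - x) + K * norm (h y - h x)"
      unfolding eventually_at_filter
    proof (intro always_eventually allI impI)
      fix y assume "y \<noteq> x"
      have "norm (c y *\<^sub>R h y - c x *\<^sub>R h x - c' (y - x) *\<^sub>R h x)
        = norm ((c y - c x - c' (y - x)) *\<^sub>R h y + c' (y - x) *\<^sub>R (h y - h x))"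
        using c(2) by (simp add: algebra_simps)
      also have "\<dots> \<le> \<bar>c y - c x - c' (y - x)\<bar> * norm (h y) + \<bar>c' (y - x)\<bar> * norm (h y - h x)"
        by (rule norm_triangle_le) simp
      also have "\<dots> \<le> \<bar>c y - c x - c' (y - x)\<bar> * norm (h y) + (norm (y - x) * K) * norm (h y - h x)"
        using K(1)[of "y - x"] by (intro add_left_mono mult_right_mono) auto
      finally show "norm (norm (c y *\<^sub>R h y - c x *\<^sub>R h x - c' (y - x) *\<^sub>R h x) / norm (y - x))
      \<le> \<bar>c y - c x - c' (y - x)\<bar> * norm (h y) / norm (y - x) + K * norm (h y - h x)"
        using \<open>y \<noteq> x\<close> by (simp add: field_simps)
    qed
  qed
  then show ?thesis
    unfolding has_derivative_iff_norm
    using bl c(2) by (simp add: bounded_linear_scaleR_const)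
qed

text \<open>
  $A(p)$ is bounded below by some $c > 0$, hence $A(y)$ is bounded below by $c/2$ for $y$
  near $p$. With $u = A(p)^{-1}v$ this bounds the norm of $A(y)^{-1}v - u$ by $2/c$ times that of
  $A(y)(A(y)^{-1}v - u) = A(p)u - A(y)u$, which tends to $0$.
\<close>
lemma continuous_on_linear_inverse:
  fixes A :: "'p::euclidean_space \<Rightarrow> 'a::euclidean_space \<Rightarrow> 'a"
  assumes lin: "\<And>y. y \<in> S \<Longrightarrow> linear (A y)" and inj: "\<And>y. y \<in> S \<Longrightarrow> inj (A y)"
    and cont: "\<And>v. continuous_on S (\<lambda>y. A y v)"
  shows "continuous_on S (\<lambda>y. inv (A y) v)"
  unfolding continuous_on
proof
  fix p assume p: "p \<in> S"
  define u where "u = inv (A p) v"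
  have surj: "A y (inv (A y) v) = v" if "y \<in> S" for y v
    using linear_injective_imp_surjective[OF lin inj, OF that that] by (simp add: surj_f_inv_f)
  obtain c where c: "c > 0" "\<And>x. c * norm x \<le> norm (A p x)"
    using linear_inj_bounded_below_pos[OF lin[OF p] inj[OF p]] by (metis mult.commute)
  let ?d = "\<lambda>y. \<Sum>b\<in>Basis. norm (A y b - A p b)"
  have Alim: "((\<lambda>y. A y b) \<longlongrightarrow> A p b) (at p within S)" for b
    using cont p by (simp add: continuous_on)
  have "(?d \<longlongrightarrow> (\<Sum>b\<in>Basis. norm (A p b - A p b))) (at p within S)"
    by (intro tendsto_intros Alim)
  then have small: "\<forall>\<^sub>F y in at p within S. ?d y < c / 2"
    using c(1) by (intro order_tendstoD(2)) auto
  have "((\<lambda>y. norm (A p u - A y u) / (c / 2)) \<longlongrightarrow> norm (A p u - A p u) / (c / 2)) (at p within S)"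
    using c(1) by (intro tendsto_intros Alim) auto
  then have lim: "((\<lambda>y. norm (A p u - A y u) / (c / 2)) \<longlongrightarrow> 0) (at p within S)" by simp
  have "((\<lambda>y. inv (A y) v - u) \<longlongrightarrow> 0) (at p within S)"
  proof (rule Lim_null_comparison[OF _ lim])
    show "\<forall>\<^sub>F y in at p within S. norm (inv (A y) v - u) \<le> norm (A p u - A y u) / (c / 2)"
    proof (rule eventually_elim2[OF small])
      show "\<forall>\<^sub>F y in at p within S. y \<in> S" by (simp add: eventually_at_filter)
      fix y assume d: "?d y < c / 2" and y: "y \<in> S"
      define x where "x = inv (A y) v - u"
      have "norm (A y x - A p x) = norm (\<Sum>b\<in>Basis. (x \<bullet> b) *\<^sub>R (A y b - A p b))"
        using linear_Basis_expansion[OF lin[OF y], of x] linear_Basis_expansion[OF lin[OF p], of x]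
        by (simp add: sum_subtractf scaleR_diff_right)
      also have "\<dots> \<le> (\<Sum>b\<in>Basis. norm x * norm (A y b - A p b))"
        by (rule sum_norm_le) (simp add: Basis_le_norm mult_right_mono)
      also have "\<dots> = norm x * ?d y" by (simp add: sum_distrib_left)
      also have "\<dots> \<le> norm x * (c / 2)" using d by (intro mult_left_mono) auto
      finally have "norm x * (c / 2) \<le> norm (A y x)"
        using c(2)[of x] norm_triangle_ineq2[of "A p x" "A y x"]
        by (simp add: norm_minus_commute algebra_simps)
      also have "A y x = A p u - A y u"
        using surj[OF y] surj[OF p] by (simp add: x_def u_def linear_diff[OF lin[OF y]])
      finally show "norm (inv (A y) v - u) \<le> norm (A p u - A y u) / (c / 2)"
        using c(1) by (simp add: x_def field_simps)
    qed
  qed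
  then show "((\<lambda>y. inv (A y) v) \<longlongrightarrow> inv (A p) v) (at p within S)"
    unfolding u_def by (rule LIM_zero_cancel)
qed

text \<open>
  The derivative of $y \<mapsto> A(y)^{-1}v$ at $p$ in direction $h$ is
  $-A(p)^{-1}\,(D_hA)(p)\,A(p)^{-1}v$. In coordinates this is a polynomial in functions that are
  $C^k$ by the hypothesis or by induction on $k$.
\<close>
lemma Ck_on_linear_inverse:
  fixes A :: "'p::euclidean_space \<Rightarrow> 'a::euclidean_space \<Rightarrow> 'a"
  assumes S: "open S"
    and lin: "\<And>y. y \<in> S \<Longrightarrow> linear (A y)" and inj: "\<And>y. y \<in> S \<Longrightarrow> inj (A y)"
  shows "(\<And>v. Ck_on k S (\<lambda>y. A y v)) \<Longrightarrow> Ck_on k S (\<lambda>y. inv (A y) v)"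
proof (induction k arbitrary: v)
  case 0
  then show ?case using continuous_on_linear_inverse[of S A v] lin inj by auto
next
  case (Suc k)
  let ?D = "\<lambda>w p. frechet_derivative (\<lambda>y. A y w) (at p)"
  have bij: "bij (A y)" if "y \<in> S" for y
    using linear_injective_imp_surjective[OF lin inj, OF that that] inj[OF that] by (simp add: bij_def)
  have linv: "linear (inv (A y))" if "y \<in> S" for y
    using inj_linear_imp_inv_linear[OF lin inj, OF that that] .
  have IH: "Ck_on k S (\<lambda>y. inv (A y) v)" for v
    by (rule Suc.IH) (rule Ck_on_SucD[OF Suc.prems])
  have cont: "continuous_on S (\<lambda>y. inv (A y) v)" for v
  proof (rule continuous_on_linear_inverse[OF lin inj])
    show "continuous_on S (\<lambda>y. A y v)" for v
      using Suc.prems[of v] by (simp add: continuous_at_imp_continuous_on differentiable_imp_continuous_within)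
  qed
  show ?case
  proof (rule Ck_on_SucI[OF S])
    fix p assume p: "p \<in> S"
    define u where "u = inv (A p) v"
    have Dp: "((\<lambda>y. A y u) has_derivative ?D u p) (at p)"
      using Ck_on_Suc_has_derivative[OF Suc.prems p] .
    \<comment> \<open>the sum is $A(y)^{-1}(A(y)u - A(p)u) = u - A(y)^{-1}v$\<close>
    have "((\<lambda>y. \<Sum>b\<in>Basis. ((A y u - A p u) \<bullet> b) *\<^sub>R inv (A y) b) has_derivative
       (\<lambda>h. \<Sum>b\<in>Basis. (?D u p h \<bullet> b) *\<^sub>R inv (A p) b)) (at p)"
    proof (intro has_derivative_sum has_derivative_scaleR_vanishing)
      fix b :: 'a
      show "((\<lambda>y. (A y u - A p u) \<bullet> b) has_derivative (\<lambda>h. ?D u p h \<bullet> b)) (at p)"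
        by (auto intro!: derivative_eq_intros Dp)
      show "isCont (\<lambda>y. inv (A y) b) p"
        using cont[of b] p by (simp add: continuous_on_eq_continuous_at[OF S])
    qed simp
    then have "((\<lambda>y. u - (\<Sum>b\<in>Basis. ((A y u - A p u) \<bullet> b) *\<^sub>R inv (A y) b)) has_derivative
       (\<lambda>h. 0 - (\<Sum>b\<in>Basis. (?D u p h \<bullet> b) *\<^sub>R inv (A p) b))) (at p)"
      by (intro has_derivative_diff has_derivative_const)
    moreover have "u - (\<Sum>b\<in>Basis. ((A y u - A p u) \<bullet> b) *\<^sub>R inv (A y) b) = inv (A y) v"
      if "y \<in> S" for y
    proof -
      have "(\<Sum>b\<in>Basis. ((A y u - A p u) \<bullet> b) *\<^sub>R inv (A y) b) = inv (A y) (A y u - A p u)"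
        by (rule linear_Basis_expansion[OF linv[OF that], symmetric])
      also have "\<dots> = u - inv (A y) v"
        using bij[OF that] bij[OF p] 
        by (simp add: linear_diff[OF linv[OF that]] u_def bij_is_inj bij_is_surj surj_f_inv_f)
      finally show ?thesis by simp
    qed
    ultimately have D: "((\<lambda>y. inv (A y) v) has_derivative
       (\<lambda>h. 0 - (\<Sum>b\<in>Basis. (?D u p h \<bullet> b) *\<^sub>R inv (A p) b))) (at p)"
      by (rule has_derivative_transform_within_open[OF _ S p])
    \<comment> \<open>$u$ depends on $p$, so the derivative of $A$ must be moved to fixed arguments $c$\<close>
    have "?D u p h = (\<Sum>c\<in>Basis. (u \<bullet> c) *\<^sub>R ?D c p h)" for h
    proof -
      have "((\<lambda>y. \<Sum>c\<in>Basis. (u \<bullet> c) *\<^sub>R A y c) has_derivative (\<lambda>h. \<Sum>c\<in>Basis. (u \<bullet> c) *\<^sub>R ?D c p h)) (at p)"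
        using Ck_on_Suc_has_derivative[OF Suc.prems p]
        by (intro has_derivative_sum has_derivative_scaleR_right)
      then have "((\<lambda>y. A y u) has_derivative (\<lambda>h. \<Sum>c\<in>Basis. (u \<bullet> c) *\<^sub>R ?D c p h)) (at p)"
        by (rule has_derivative_transform_within_open[OF _ S p])
          (rule linear_Basis_expansion[OF lin, symmetric])
      from has_derivative_unique[OF Dp this] show ?thesis by (rule fun_cong)
    qed
    with D show "((\<lambda>y. inv (A y) v) has_derivative
       (\<lambda>h. - (\<Sum>b\<in>Basis. ((\<Sum>c\<in>Basis. (inv (A p) v \<bullet> c) *\<^sub>R ?D c p h) \<bullet> b) *\<^sub>R inv (A p) b))) (at p)"
      by (simp add: u_def)
  next
    fix h
    show "Ck_on k S (\<lambda>p. - (\<Sum>b\<in>Basis. ((\<Sum>c\<in>Basis. (inv (A p) v \<bullet> c) *\<^sub>R ?D c p h) \<bullet> b) *\<^sub>R inv (A p) b))"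
    proof (intro Ck_on_uminus[OF S] Ck_on_sum[OF S] Ck_on_bilinear[OF S bounded_bilinear_scaleR]
        Ck_on_bilinear[OF S bounded_bilinear_inner])
      fix b c :: 'a
      show "Ck_on k S (\<lambda>p. inv (A p) v)" "Ck_on k S (\<lambda>p. inv (A p) b)" by (rule IH)+
      show "Ck_on k S (\<lambda>p. c)" "Ck_on k S (\<lambda>p. b)" by (rule Ck_on_const[OF S])+
      show "Ck_on k S (\<lambda>p. ?D c p h)" using Suc.prems[of c] by simp
    qed
  qed
qed

section \<open>Smooth maps and the inverse function theorem\<close>

lemma smooth_on_subset: "smooth_on S f \<Longrightarrow> T \<subseteq> S \<Longrightarrow> smooth_on T f"
  unfolding smooth_on_def by (intro allI) (rule Ck_on_subset, erule spec)

lemma smooth_on_cong: "open S \<Longrightarrow> (\<And>x. x \<in> S \<Longrightarrow> f x = g x) \<Longrightarrow> smooth_on S f \<longleftrightarrow> smooth_on S g"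
  unfolding smooth_on_def by (simp only: Ck_on_cong[of S f g])

lemma smooth_on_const: "open S \<Longrightarrow> smooth_on S (\<lambda>x. c)"
  by (simp add: smooth_on_def Ck_on_const)

lemma smooth_on_linear: "open S \<Longrightarrow> bounded_linear f \<Longrightarrow> smooth_on S f"
  by (simp add: smooth_on_def Ck_on_linear)

lemma smooth_on_add: "open S \<Longrightarrow> smooth_on S f \<Longrightarrow> smooth_on S g \<Longrightarrow> smooth_on S (\<lambda>x. f x + g x)"
  by (simp add: smooth_on_def Ck_on_add)

lemma smooth_on_uminus: "open S \<Longrightarrow> smooth_on S f \<Longrightarrow> smooth_on S (\<lambda>x. - f x)"
  by (simp add: smooth_on_def Ck_on_uminus)

lemma smooth_on_diff: "open S \<Longrightarrow> smooth_on S f \<Longrightarrow> smooth_on S g \<Longrightarrow> smooth_on S (\<lambda>x. f x - g x)"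
  unfolding diff_conv_add_uminus by (intro smooth_on_add smooth_on_uminus)

lemma smooth_on_sum:
  "open S \<Longrightarrow> (\<And>i. i \<in> I \<Longrightarrow> smooth_on S (f i)) \<Longrightarrow> smooth_on S (\<lambda>x. \<Sum>i\<in>I. f i x)"
  by (simp add: smooth_on_def Ck_on_sum)

lemma smooth_on_scaleR:
  "open S \<Longrightarrow> smooth_on S f \<Longrightarrow> smooth_on S g \<Longrightarrow> smooth_on S (\<lambda>x. f x *\<^sub>R g x)"
  by (simp add: smooth_on_def Ck_on_bilinear[OF _ bounded_bilinear_scaleR])

lemma smooth_on_inner:
  "open S \<Longrightarrow> smooth_on S f \<Longrightarrow> smooth_on S g \<Longrightarrow> smooth_on S (\<lambda>x. f x \<bullet> g x)"
  by (simp add: smooth_on_def Ck_on_bilinear[OF _ bounded_bilinear_inner])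

lemma smooth_on_Pair:
  "open S \<Longrightarrow> smooth_on S f \<Longrightarrow> smooth_on S g \<Longrightarrow> smooth_on S (\<lambda>x. (f x, g x))"
  by (simp add: smooth_on_def Ck_on_Pair)

lemma smooth_on_compose:
  assumes "open S" "open T" "f ` S \<subseteq> T" "smooth_on T g" "smooth_on S f"
  shows "smooth_on S (\<lambda>x. g (f x))"
  unfolding smooth_on_def
  by (rule allI, rule Ck_on_compose[OF assms(1-3)]) (use assms(4,5) in \<open>simp_all add: smooth_on_def\<close>)

lemma smooth_on_linear_compose:
  assumes "open S" "bounded_linear g" "smooth_on S f"
  shows "smooth_on S (\<lambda>x. g (f x))"
  by (rule smooth_on_compose[OF assms(1) open_UNIV subset_UNIV
        smooth_on_linear[OF open_UNIV assms(2)] assms(3)])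

lemma smooth_on_has_derivative:
  assumes "smooth_on S f" "x \<in> S"
  shows "(f has_derivative frechet_derivative f (at x)) (at x)"
proof (rule Ck_on_Suc_has_derivative[OF _ assms(2)])
  show "Ck_on (Suc 0) S f" using assms(1) unfolding smooth_on_def by (rule spec)
qed

lemma smooth_on_frechet_derivative:
  assumes "smooth_on S f"
  shows "smooth_on S (\<lambda>x. frechet_derivative f (at x) v)"
  unfolding smooth_on_def
proof
  fix k
  have "Ck_on (Suc k) S f" using assms unfolding smooth_on_def by (rule spec)
  then show "Ck_on k S (\<lambda>x. frechet_derivative f (at x) v)" by simp
qed

lemma smooth_on_imp_continuous_on: "smooth_on S f \<Longrightarrow> continuous_on S f"
  unfolding smooth_on_def by (drule spec[of _ 0]) simp

text \<open>
  The local inverse $g$ satisfies $Dg(y) = Df(g(y))^{-1}$. If $g$ is $C^k$, then so is the right-hand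
  side, hence $g$ is $C^{k+1}$.
\<close>
lemma smooth_inverse_function:
  fixes f :: "'a::euclidean_space \<Rightarrow> 'a"
  assumes S: "open S" and f: "smooth_on S f" and x0: "x0 \<in> S"
    and inj0: "inj (frechet_derivative f (at x0))"
  obtains W V g where "open W" "W \<subseteq> S" "x0 \<in> W" "open V" "f x0 \<in> V" "homeomorphism W V f g"
    "smooth_on V g" "(g has_derivative inv (frechet_derivative f (at x0))) (at (f x0))"
proof -
  let ?D = "\<lambda>x. frechet_derivative f (at x)"
  define f' where "f' x = Blinfun (?D x)" for x
  have D: "(f has_derivative ?D x) (at x)" if "x \<in> S" for x
    by (rule smooth_on_has_derivative[OF f that])
  have f'_eq: "blinfun_apply (f' x) = ?D x" if "x \<in> S" for x
    unfolding f'_def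
    by (rule bounded_linear_Blinfun_apply) (rule has_derivative_bounded_linear[OF D[OF that]])
  have der: "(f has_derivative blinfun_apply (f' x)) (at x)" if "x \<in> S" for x
    using D[OF that] by (simp only: f'_eq[OF that])
  have cont: "continuous_on S f'"
  proof (rule continuous_on_blinfun_componentwise)
    fix i :: 'a
    have "continuous_on S (\<lambda>x. ?D x i)"
      by (rule smooth_on_imp_continuous_on[OF smooth_on_frechet_derivative[OF f]])
    then show "continuous_on S (\<lambda>x. blinfun_apply (f' x) i)"
      by (subst continuous_on_cong[OF refl, of _ _ "\<lambda>x. ?D x i"]) (simp_all add: f'_eq)
  qed
  have bl0: "bounded_linear (?D x0)" by (rule has_derivative_bounded_linear[OF D[OF x0]])
  define invf where "invf = Blinfun (inv (?D x0))"
  have invf_eq: "blinfun_apply invf = inv (?D x0)"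
    unfolding invf_def
    by (rule bounded_linear_Blinfun_apply, rule inj_linear_imp_inv_bounded_linear[OF bl0 inj0])
  have inv: "invf o\<^sub>L f' x0 = id_blinfun"
    by (rule blinfun_eqI) (simp add: invf_eq f'_eq[OF x0] inv_f_f[OF inj0])
  obtain W V g g' where W: "open W" "W \<subseteq> S" "x0 \<in> W" and V: "open V" "f x0 \<in> V"
    and hom: "homeomorphism W V f g"
    and g: "\<And>y. y \<in> V \<Longrightarrow> (g has_derivative (g' y)) (at y)"
    and g'0: "\<And>y. y \<in> V \<Longrightarrow> g' y = inv (blinfun_apply (f' (g y)))"
    and bij0: "\<And>y. y \<in> V \<Longrightarrow> bij (blinfun_apply (f' (g y)))"
    by (rule inverse_function_theorem[OF S der cont x0 inv]) blast+
  have gV: "g ` V = W" and gf: "\<And>x. x \<in> W \<Longrightarrow> g (f x) = x"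
    using hom by (auto simp: homeomorphism_def)
  have gS: "g y \<in> S" if "y \<in> V" for y using that gV W(2) by blast
  have g': "g' y = inv (?D (g y))" if "y \<in> V" for y
    using g'0[OF that] f'_eq[OF gS[OF that]] by simp
  have inj: "inj (?D (g y))" if "y \<in> V" for y
    using bij0[OF that] f'_eq[OF gS[OF that]] by (simp add: bij_def)
  have lin: "linear (?D (g y))" if "y \<in> V" for y
    by (rule has_derivative_linear[OF D[OF gS[OF that]]])
  have "Ck_on k V g" for k
  proof (induction k)
    case 0
    then show ?case using hom by (simp add: homeomorphism_def)
  next
    case (Suc k)
    show ?case
    proof (rule Ck_on_SucI[OF V(1) g])
      fix v
      have "Ck_on k S (\<lambda>x. ?D x v)" for v
        using smooth_on_frechet_derivative[OF f, of v] by (simp add: smooth_on_def)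
      then have comp: "Ck_on k V (\<lambda>y. ?D (g y) v)" for v
        by (rule Ck_on_compose[OF V(1) S _ _ Suc, rotated]) (use gS in auto)
      have "Ck_on k V (\<lambda>y. inv (?D (g y)) v)"
        by (rule Ck_on_linear_inverse[where A = "\<lambda>y. ?D (g y)", OF V(1)])
          (simp_all add: lin inj comp)
      then show "Ck_on k V (\<lambda>y. g' y v)"
        by (subst Ck_on_cong[OF V(1), of _ "\<lambda>y. inv (?D (g y)) v"]) (simp_all add: g')
    qed
  qed
  then have "smooth_on V g" by (simp add: smooth_on_def)
  moreover have "(g has_derivative inv (?D x0)) (at (f x0))"
    using g[OF V(2)] g'[OF V(2)] gf[OF W(3)] by simp
  ultimately show thesis using that W V hom by blast
qed

section \<open>Diffeomorphisms and submanifolds\<close>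

lemma smooth_map_restrict:
  assumes "open W" "smooth_on W f" "M \<subseteq> W"
  shows "smooth_map M f"
  unfolding smooth_map_def
proof
  fix x assume "x \<in> M"
  then show "\<exists>W g. open W \<and> x \<in> W \<and> smooth_on W g \<and> (\<forall>y\<in>W \<inter> M. g y = f y)"
    using assms by (intro exI[of _ W] exI[of _ f]) auto
qed

text \<open>
  A left inverse that is given on an open neighbourhood of the image replaces the inverse chosen by
  \<^const>\<open>inv_into\<close>, and its smoothness can be checked on an open set.
\<close>
lemma diffeomorphismI:
  assumes "f ` M = M'" "\<And>x. x \<in> M \<Longrightarrow> g (f x) = x"
    and "open W" "M \<subseteq> W" "smooth_on W f" "open V" "M' \<subseteq> V" "smooth_on V g"
  shows "diffeomorphism M M' f"
proof -
  have inj: "inj_on f M" using assms(2) by (rule inj_on_inverseI)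
  have eq: "inv_into M f y = g y" if "y \<in> M'" for y
    using that unfolding assms(1)[symmetric] by (auto simp: inv_into_f_f[OF inj] assms(2))
  have "smooth_map M' (inv_into M f)"
    unfolding smooth_map_def
  proof
    fix y assume "y \<in> M'"
    then show "\<exists>W h. open W \<and> y \<in> W \<and> smooth_on W h \<and> (\<forall>y'\<in>W \<inter> M'. h y' = inv_into M f y')"
      using assms(6,7,8) eq by (intro exI[of _ V] exI[of _ g]) auto
  qed
  then show ?thesis
    unfolding diffeomorphism_def
    using inj assms(1) smooth_map_restrict[OF assms(3,5,4)] by (simp add: bij_betw_def)
qed

lemma homeomorphism_smooth_imp_diffeomorphism:
  assumes "homeomorphism W V f g" "open W" "open V" "smooth_on W f" "smooth_on V g"
  shows "diffeomorphism W V f"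
  by (rule diffeomorphismI[of f W V g W V]) (use assms in \<open>auto simp: homeomorphism_def\<close>)

lemma smooth_submanifold_slice:
  fixes \<phi> :: "'a::euclidean_space \<Rightarrow> 'a"
  assumes "open W" "open V" "diffeomorphism W V \<phi>" "subspace L" "dim L = k"
    and "M \<subseteq> W" "\<phi> ` M = V \<inter> L"
  shows "smooth_submanifold k M"
proof -
  have sl: "\<phi> ` (W \<inter> M) = V \<inter> L" using assms(6,7) by (simp add: Int_absorb1)
  show ?thesis
    unfolding smooth_submanifold_def
    by (rule ballI, rule exI[of _ W], rule exI[of _ V], rule exI[of _ \<phi>], rule exI[of _ L])
      (use assms sl in auto)
qed

section \<open>Regular envelopes\<close>

text \<open>
  The envelope of a family of hypersurfaces $\{F(w, \cdot) = 0\}$, where $K$ takes the place of the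
  parameter gradient of $F$ and the injectivity of its partial derivative in $w$ that of
  $\<Delta> \<noteq> 0$. The proof straightens the zero set by a chart $\<Phi>$ and its projection by
  $\<sigma>^{-1} = \<tau>$.
\<close>
lemma smooth_envelope:
  fixes K :: "'a::euclidean_space \<times> 'b::euclidean_space \<Rightarrow> 'a" and F :: "'a \<times> 'b \<Rightarrow> real"
  assumes S: "open S" and K: "smooth_on S K" and F: "smooth_on S F" and z0: "z0 \<in> S"
    and K0: "K z0 = 0" and F0: "F z0 = 0"
    and Kinj: "\<And>a. frechet_derivative K (at z0) (a, 0) = 0 \<Longrightarrow> a = 0"
    and Fa: "\<And>a. frechet_derivative F (at z0) (a, 0) = 0"
    and Fx: "\<exists>x. frechet_derivative F (at z0) (0, x) \<noteq> 0"
  defines "Z \<equiv> {z \<in> S. F z = 0 \<and> K z = 0}"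
  shows "\<exists>W H. open W \<and> z0 \<in> W \<and> smooth_submanifold (DIM('b) - 1) (W \<inter> Z) \<and>
     smooth_submanifold (DIM('b) - 1) H \<and> snd z0 \<in> H \<and> diffeomorphism (W \<inter> Z) H snd"
proof -
  let ?DK = "frechet_derivative K (at z0)" and ?DF = "frechet_derivative F (at z0)"
  have DK: "(K has_derivative ?DK) (at z0)" by (rule smooth_on_has_derivative[OF K z0])
  have DF: "(F has_derivative ?DF) (at z0)" by (rule smooth_on_has_derivative[OF F z0])
  have linF: "linear ?DF" by (rule has_derivative_linear[OF DF])
  define m :: 'b where "m = (\<Sum>b\<in>Basis. ?DF (0, b) *\<^sub>R b)"
  have DF0: "?DF (0, x) = m \<bullet> x" for x
  proof -
    have l: "linear (\<lambda>x. ?DF (0, x))"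
      by (rule linear_compose[OF _ linF, unfolded o_def]) (simp add: linear_iff)
    show ?thesis
      unfolding m_def inner_sum_left inner_scaleR_left
      by (subst linear_Basis_expansion[OF l]) (simp add: inner_commute mult.commute)
  qed
  have DFeq: "?DF (a, x) = m \<bullet> x" for a x
    using linear_add[OF linF, of "(a, 0)" "(0, x)"] Fa[of a] DF0[of x] by simp
  have m0: "m \<noteq> 0" using Fx DF0 by auto
  define e where "e = m /\<^sub>R (m \<bullet> m)"
  have me: "m \<bullet> e = 1" using m0 by (simp add: e_def)
  \<comment> \<open>the second component replaces the coordinate of $X$ along $m$ by the value of $F$\<close>
  define \<Phi> where "\<Phi> z = (K z, snd z + (F z - m \<bullet> snd z) *\<^sub>R e)" for z
  have \<Phi>m: "m \<bullet> snd (\<Phi> z) = F z" for z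
    by (simp add: \<Phi>_def inner_add_right me)
  have sm_snd: "smooth_on S snd" if "open S" for S :: "('a \<times> 'b) set"
    by (rule smooth_on_linear[OF that bounded_linear_snd])
  have \<Phi>: "smooth_on S \<Phi>"
    unfolding \<Phi>_def
    by (intro smooth_on_Pair smooth_on_add smooth_on_scaleR smooth_on_diff smooth_on_inner
        smooth_on_const sm_snd S K F)
  have D\<Phi>: "(\<Phi> has_derivative (\<lambda>h. (?DK h, snd h + (?DF h - m \<bullet> snd h) *\<^sub>R e))) (at z0)"
    unfolding \<Phi>_def
    by (intro has_derivative_Pair DK has_derivative_add has_derivative_scaleR_left has_derivative_diff
        DF has_derivative_inner_right has_derivative_snd has_derivative_ident)
  have D\<Phi>eq: "frechet_derivative \<Phi> (at z0) (a, x) = (?DK (a, x), x)" for a x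
    using fun_cong[OF frechet_derivative_at[OF D\<Phi>], of "(a, x)"] by (simp add: DFeq)
  have inj\<Phi>: "inj (frechet_derivative \<Phi> (at z0))"
  proof (rule linear_injective_0[THEN iffD2, rule_format])
    show "linear (frechet_derivative \<Phi> (at z0))"
      by (rule has_derivative_linear[OF smooth_on_has_derivative[OF \<Phi> z0]])
    fix h assume h: "frechet_derivative \<Phi> (at z0) h = 0"
    obtain a x where ax: "h = (a, x)" by (cases h)
    have "?DK (a, x) = 0 \<and> x = 0"
      using h unfolding ax D\<Phi>eq zero_prod_def prod.inject .
    then have x: "x = 0" and "?DK (a, x) = 0" by blast+
    then have "?DK (a, 0) = 0" by simp
    then have "a = 0" by (rule Kinj)
    with x show "h = 0" by (simp add: ax zero_prod_def)
  qed
  obtain W1 V1 g where W1: "open W1" "W1 \<subseteq> S" "z0 \<in> W1" and V1: "open V1" "\<Phi> z0 \<in> V1"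
    and hom1: "homeomorphism W1 V1 \<Phi> g" and g: "smooth_on V1 g"
    and Dg: "(g has_derivative inv (frechet_derivative \<Phi> (at z0))) (at (\<Phi> z0))"
    by (rule smooth_inverse_function[OF S \<Phi> z0 inj\<Phi>])
  have h1: "\<Phi> ` W1 = V1" "g ` V1 = W1" "\<And>z. z \<in> W1 \<Longrightarrow> g (\<Phi> z) = z" "\<And>y. y \<in> V1 \<Longrightarrow> \<Phi> (g y) = y"
    by (rule homeomorphism_image1[OF hom1], rule homeomorphism_image2[OF hom1],
      rule homeomorphism_apply1[OF hom1], assumption, rule homeomorphism_apply2[OF hom1])
  define Y0 where "Y0 = snd (\<Phi> z0)"
  have \<Phi>z0: "\<Phi> z0 = (0, Y0)" by (simp add: Y0_def \<Phi>_def K0)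
  define T where "T = {Y. (0::'a, Y) \<in> V1}"
  have inc: "bounded_linear (\<lambda>Y::'b. (0::'a, Y))"
    by (intro bounded_linear_Pair bounded_linear_zero bounded_linear_ident)
  have T: "open T"
    using open_vimage[OF V1(1), of "\<lambda>Y. (0, Y)"] linear_continuous_on[OF inc, of UNIV]
    by (simp add: T_def vimage_def)
  have Y0: "Y0 \<in> T" using V1(2) by (simp add: T_def \<Phi>z0)
  have g0: "smooth_on T (\<lambda>Y. g (0, Y))"
    by (rule smooth_on_compose[OF T V1(1) _ g smooth_on_linear[OF T inc]]) (auto simp: T_def)
  \<comment> \<open>the point of $X$-space over the point of $\{K = 0\}$ with chart coordinate $Y$\<close>
  define \<sigma> where "\<sigma> Y = snd (g (0, Y))" for Y
  have \<sigma>: "smooth_on T \<sigma>"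
    unfolding \<sigma>_def by (rule smooth_on_linear_compose[OF T bounded_linear_snd g0])
  have D\<sigma>: "(\<sigma> has_derivative (\<lambda>y. snd (inv (frechet_derivative \<Phi> (at z0)) (0, y)))) (at Y0)"
  proof -
    have "((\<lambda>Y. (0::'a, Y)) has_derivative (\<lambda>y. (0, y))) (at Y0)"
      by (rule bounded_linear_imp_has_derivative[OF inc])
    from diff_chain_at[OF this, of g] Dg
    have "((\<lambda>Y. g (0, Y)) has_derivative (\<lambda>y. inv (frechet_derivative \<Phi> (at z0)) (0, y))) (at Y0)"
      by (simp add: \<Phi>z0 o_def)
    then show ?thesis unfolding \<sigma>_def by (rule has_derivative_snd)
  qed
  have D\<sigma>eq: "frechet_derivative \<sigma> (at Y0) y = y" for y
  proof -
    have "surj (frechet_derivative \<Phi> (at z0))"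
      by (rule linear_inj_imp_surj[OF
            has_derivative_linear[OF smooth_on_has_derivative[OF \<Phi> z0]] inj\<Phi>])
    then have *: "frechet_derivative \<Phi> (at z0) (inv (frechet_derivative \<Phi> (at z0)) (0, y)) = (0, y)"
      by (rule surj_f_inv_f)
    obtain a x where ax: "inv (frechet_derivative \<Phi> (at z0)) (0, y) = (a, x)" by fastforce
    have "x = y" using * unfolding ax D\<Phi>eq by simp
    then show ?thesis using fun_cong[OF frechet_derivative_at[OF D\<sigma>], of y] ax by simp
  qed
  have inj\<sigma>: "inj (frechet_derivative \<sigma> (at Y0))"
    by (rule injI) (simp add: D\<sigma>eq)
  obtain W2 V2 \<tau> where W2: "open W2" "W2 \<subseteq> T" "Y0 \<in> W2" and V2: "open V2" "\<sigma> Y0 \<in> V2"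
    and hom2: "homeomorphism W2 V2 \<sigma> \<tau>" and \<tau>: "smooth_on V2 \<tau>"
    by (rule smooth_inverse_function[OF T \<sigma> Y0 inj\<sigma>])
  have h2: "\<sigma> ` W2 = V2" "\<tau> ` V2 = W2" "\<And>Y. Y \<in> W2 \<Longrightarrow> \<tau> (\<sigma> Y) = Y" "\<And>X. X \<in> V2 \<Longrightarrow> \<sigma> (\<tau> X) = X"
    by (rule homeomorphism_image1[OF hom2], rule homeomorphism_image2[OF hom2],
      rule homeomorphism_apply1[OF hom2], assumption, rule homeomorphism_apply2[OF hom2])
  define P where "P = {Y. m \<bullet> Y = 0}"
  have P: "subspace P" "dim P = DIM('b) - 1"
    using m0 by (simp_all add: P_def subspace_hyperplane dim_hyperplane)
  \<comment> \<open>shrink the chart so that its slice is exactly the domain on which $\<sigma>$ is invertible\<close>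
  define V where "V = V1 \<inter> UNIV \<times> W2"
  have V: "open V" "V \<subseteq> V1" using V1(1) W2(1) by (auto simp: V_def open_Times)
  define W where "W = W1 \<inter> \<Phi> -` V"
  have \<Phi>c: "continuous_on W1 \<Phi>" using hom1 by (simp add: homeomorphism_def)
  have W: "open W" "W \<subseteq> W1"
    using continuous_open_preimage[OF \<Phi>c W1(1) V(1)] by (simp_all add: W_def)
  have \<Phi>W: "\<Phi> ` W = V" using h1(1) V(2) by (auto simp: W_def)
  have WS: "W \<subseteq> S" using W(2) W1(2) by blast
  have z0W: "z0 \<in> W"
    using W1(3) V1(2) W2(3) by (simp add: W_def V_def \<Phi>z0)
  define H where "H = \<sigma> ` (W2 \<inter> P)"
  have HV2: "H \<subseteq> V2" using h2(1) by (auto simp: H_def)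
  have \<tau>H: "\<tau> ` H = W2 \<inter> P"
    unfolding H_def image_image by (simp add: h2(3))
  have Z: "z \<in> Z \<longleftrightarrow> \<Phi> z \<in> {0} \<times> P" if "z \<in> W" for z
  proof -
    have "fst (\<Phi> z) = K z" by (simp add: \<Phi>_def)
    moreover have "z \<in> S" using that WS by blast
    ultimately show ?thesis
      by (simp add: Z_def P_def mem_Times_iff \<Phi>m conj_commute)
  qed
  have \<Phi>WZ: "\<Phi> ` (W \<inter> Z) = V \<inter> ({0} \<times> P)"
  proof
    show "\<Phi> ` (W \<inter> Z) \<subseteq> V \<inter> ({0} \<times> P)"
      unfolding \<Phi>W[symmetric] using Z by auto
    show "V \<inter> ({0} \<times> P) \<subseteq> \<Phi> ` (W \<inter> Z)"
    proof
      fix y assume y: "y \<in> V \<inter> ({0} \<times> P)"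
      then obtain z where "z \<in> W" "y = \<Phi> z" unfolding \<Phi>W[symmetric] by blast
      with y Z[of z] show "y \<in> \<Phi> ` (W \<inter> Z)" by simp
    qed
  qed
  have dW: "diffeomorphism W V \<Phi>"
    by (rule diffeomorphismI[OF \<Phi>W _ W(1) order_refl smooth_on_subset[OF \<Phi> WS]
          V1(1) V(2) g]) (use h1(3) W(2) in blast)
  have subZ: "smooth_submanifold (DIM('b) - 1) (W \<inter> Z)"
  proof (rule smooth_submanifold_slice[OF W(1) V(1) dW _ _ Int_lower1 \<Phi>WZ])
    show "subspace ({0::'a} \<times> P)" using P(1) by (intro subspace_Times) (simp_all add: subspace_def)
    have "subspace {0::'a}" by (simp add: subspace_def)
    from dim_Times[OF this P(1)] show "dim ({0::'a} \<times> P) = DIM('b) - 1" by (simp add: P(2))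
  qed
  have subH: "smooth_submanifold (DIM('b) - 1) H"
  proof (rule smooth_submanifold_slice[OF V2(1) W2(1) _ P HV2 \<tau>H])
    show "diffeomorphism V2 W2 \<tau>"
      by (rule homeomorphism_smooth_imp_diffeomorphism[OF homeomorphism_symD[OF hom2] V2(1) W2(1) \<tau>
            smooth_on_subset[OF \<sigma> W2(2)]])
  qed
  have zg: "\<exists>Y\<in>W2 \<inter> P. z = g (0, Y)" if "z \<in> W \<inter> Z" for z
  proof -
    have "\<Phi> z \<in> V \<inter> ({0} \<times> P)" unfolding \<Phi>WZ[symmetric] using that by (rule imageI)
    then obtain Y where "Y \<in> W2 \<inter> P" "\<Phi> z = (0, Y)" by (auto simp: V_def)
    moreover have "g (\<Phi> z) = z" using that W(2) by (intro h1(3)) auto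
    ultimately show ?thesis by auto
  qed
  have gz: "g (0, Y) \<in> W \<inter> Z" if "Y \<in> W2 \<inter> P" for Y
  proof -
    have Y: "(0, Y) \<in> V1" using that W2(2) by (auto simp: T_def)
    then have "(0, Y) \<in> V \<inter> ({0} \<times> P)" using that by (simp add: V_def)
    then have "(0, Y) \<in> \<Phi> ` (W \<inter> Z)" by (simp only: \<Phi>WZ)
    then obtain z where z: "z \<in> W \<inter> Z" "(0, Y) = \<Phi> z" by (rule imageE)
    then have "g (0, Y) = z" using h1(3)[of z] W(2) by auto
    with z(1) show ?thesis by simp
  qed
  have snd_im: "snd ` (W \<inter> Z) = H"
  proof
    show "snd ` (W \<inter> Z) \<subseteq> H"
    proof
      fix x assume "x \<in> snd ` (W \<inter> Z)"
      then obtain z where z: "z \<in> W \<inter> Z" "x = snd z" by blast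
      from zg[OF z(1)] obtain Y where "Y \<in> W2 \<inter> P" "z = g (0, Y)" by blast
      then show "x \<in> H" by (simp add: H_def \<sigma>_def z(2))
    qed
    show "H \<subseteq> snd ` (W \<inter> Z)"
      unfolding H_def \<sigma>_def by (intro image_subsetI imageI gz)
  qed
  have "diffeomorphism (W \<inter> Z) H snd"
  proof (rule diffeomorphismI[OF snd_im _ open_UNIV subset_UNIV sm_snd[OF open_UNIV] V2(1) HV2])
    show "smooth_on V2 (\<lambda>X. g (0, \<tau> X))"
      by (rule smooth_on_compose[OF V2(1) T _ g0 \<tau>]) (use h2(2) W2(2) in blast)
    fix z assume "z \<in> W \<inter> Z"
    then obtain Y where Y: "Y \<in> W2" "z = g (0, Y)" using zg by blast
    then show "g (0, \<tau> (snd z)) = z" using h2(3)[OF Y(1)] by (simp add: \<sigma>_def)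
  qed
  moreover have "z0 \<in> Z" by (simp add: Z_def z0 K0 F0)
  then have "snd z0 \<in> H" using snd_im z0W by blast
  ultimately show ?thesis using W(1) z0W subZ subH by blast
qed

section \<open>The family of mid-hyperplanes\<close>

lemma partial_deriv_eq:
  assumes "(f has_derivative D) (at x)"
  shows "partial_deriv b f x = D b"
proof -
  have lin: "linear D" by (rule has_derivative_linear[OF assms])
  have "((\<lambda>t::real. x + t *\<^sub>R b) has_derivative (\<lambda>t. 0 + t *\<^sub>R b)) (at 0)"
    by (intro has_derivative_add has_derivative_const has_derivative_scaleR_left has_derivative_ident)
  from diff_chain_at[OF this, of f D] assms
  have "((\<lambda>t. f (x + t *\<^sub>R b)) has_derivative (\<lambda>t. D (t *\<^sub>R b))) (at 0)"
    by (simp add: o_def)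
  moreover have "(\<lambda>t. D (t *\<^sub>R b)) = (*) (D b)"
    by (rule ext) (simp add: linear_scale[OF lin] mult.commute)
  ultimately have "((\<lambda>t. f (x + t *\<^sub>R b)) has_field_derivative D b) (at 0)"
    by (simp add: has_field_derivative_def)
  then show ?thesis unfolding partial_deriv_def by (rule DERIV_imp_deriv)
qed

lemma partial_deriv_frechet_derivative:
  "smooth_on S f \<Longrightarrow> x \<in> S \<Longrightarrow> partial_deriv b f x = frechet_derivative f (at x) b"
  by (rule partial_deriv_eq[OF smooth_on_has_derivative])

lemma smooth_on_partial_deriv:
  assumes "open S" "smooth_on S f"
  shows "smooth_on S (partial_deriv b f)"
  by (subst smooth_on_cong[OF assms(1) partial_deriv_frechet_derivative[OF assms(2)]], assumption)
    (rule smooth_on_frechet_derivative[OF assms(2)])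

text \<open>
  Lets partial derivatives in the parameters, with $X$ fixed, be treated as derivatives of one
  function on the product, where joint smoothness is available.
\<close>
lemma partial_deriv_slice:
  "partial_deriv a (\<lambda>w'. f (w', X)) w = partial_deriv (a, 0) f (w, X)"
  by (simp add: partial_deriv_def)

lemma vec_lambda_eq_sum_axis: "(\<chi> i. c i) = (\<Sum>i\<in>UNIV. c i *\<^sub>R axis i (1::real))"
  by (simp add: vec_eq_iff axis_def if_distrib cong: if_cong)

lemma smooth_on_graph_normal:
  assumes "open U" "smooth_on U f"
  shows "smooth_on U (graph_normal f)"
  unfolding graph_normal_def vec_lambda_eq_sum_axis
  by (intro smooth_on_Pair smooth_on_sum smooth_on_scaleR smooth_on_uminus smooth_on_const
      smooth_on_partial_deriv assms)

lemma smooth_on_graph_point: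
  assumes "open U" "smooth_on U f"
  shows "smooth_on U (graph_point f)"
  unfolding graph_point_def
  by (intro smooth_on_Pair assms smooth_on_linear[OF _ bounded_linear_ident])

lemma smooth_on_emh_F:
  assumes U: "open U1" "open U2" and f: "smooth_on U1 f1" "smooth_on U2 f2"
  shows "smooth_on ((U1 \<times> U2) \<times> UNIV) (\<lambda>z. emh_F f1 f2 (fst z) (snd z))"
proof -
  let ?S = "(U1 \<times> U2) \<times> (UNIV :: ((real^'a) \<times> real) set)"
  have S: "open ?S" using U by (intro open_Times open_UNIV)
  have bl: "bounded_linear (\<lambda>z. fst (fst z))" "bounded_linear (\<lambda>z. snd (fst z))"
    by (intro bounded_linear_fst_comp bounded_linear_snd_comp bounded_linear_fst)+
  note sm = smooth_on_linear[OF S bl(1)] smooth_on_linear[OF S bl(2)]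
    smooth_on_linear[OF S bounded_linear_snd]
  have im: "(\<lambda>z. fst (fst z)) ` ?S \<subseteq> U1" "(\<lambda>z. snd (fst z)) ` ?S \<subseteq> U2" by auto
  note N = smooth_on_compose[OF S U(1) im(1) smooth_on_graph_normal[OF U(1) f(1)] sm(1)]
    smooth_on_compose[OF S U(2) im(2) smooth_on_graph_normal[OF U(2) f(2)] sm(2)]
  note p = smooth_on_compose[OF S U(1) im(1) smooth_on_graph_point[OF U(1) f(1)] sm(1)]
    smooth_on_compose[OF S U(2) im(2) smooth_on_graph_point[OF U(2) f(2)] sm(2)]
  have "emh_F f1 f2 (fst z) (snd z) =
     (let N1 = graph_normal f1 (fst (fst z)); N2 = graph_normal f2 (snd (fst z));
          p1 = graph_point f1 (fst (fst z)); p2 = graph_point f2 (snd (fst z))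
      in ((N1 \<bullet> ((1/2) *\<^sub>R (p1 - p2))) *\<^sub>R N2 + (N2 \<bullet> ((1/2) *\<^sub>R (p1 - p2))) *\<^sub>R N1) \<bullet>
         (snd z - (1/2) *\<^sub>R (p1 + p2)))" for z
    by (cases z; cases "fst z") (simp add: emh_F_def Let_def)
  then show ?thesis
    unfolding Let_def
    by (simp only:) (intro smooth_on_inner smooth_on_add smooth_on_scaleR smooth_on_diff
        smooth_on_const S N p sm(3))
qed

lemma sum_param_axis:
  "(\<Sum>a\<in>UNIV. c a *\<^sub>R param_axis a) = ((\<chi> i. c (Inl i)), (\<chi> i. c (Inr i)))"
proof -
  have "(\<Sum>a\<in>UNIV. c a *\<^sub>R param_axis a)
      = (\<Sum>i\<in>UNIV. c (Inl i) *\<^sub>R param_axis (Inl i)) + (\<Sum>i\<in>UNIV. c (Inr i) *\<^sub>R param_axis (Inr i))"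
    unfolding UNIV_Plus_UNIV[symmetric] by (subst sum.Plus) simp_all
  then show ?thesis
    by (simp add: vec_lambda_eq_sum_axis prod_eq_iff fst_sum snd_sum)
qed

lemma sum_param_axis_eq_0: "(\<Sum>a\<in>UNIV. c a *\<^sub>R param_axis a) = 0 \<longleftrightarrow> (\<forall>a. c a = 0)"
  by (auto simp: sum_param_axis zero_prod_def vec_eq_iff split_sum_all)

lemma param_axis_coordinates:
  fixes v :: "(real^'n) \<times> (real^'n)"
  obtains c where "v = (\<Sum>a\<in>UNIV. c a *\<^sub>R param_axis a)"
proof
  show "v = (\<Sum>a\<in>UNIV. (case a of Inl i \<Rightarrow> fst v $ i | Inr i \<Rightarrow> snd v $ i) *\<^sub>R param_axis a)"
    by (simp add: sum_param_axis prod_eq_iff vec_eq_iff)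
qed

text \<open>
  Expresses derivatives in an arbitrary parameter direction by the partial derivatives that enter
  $G$ and $\<Delta>$.
\<close>
lemma linear_slice_param_axis:
  fixes D :: "((real^'n) \<times> (real^'n)) \<times> 'x::real_vector \<Rightarrow> real"
  assumes "linear D"
  shows "D (\<Sum>a\<in>UNIV. c a *\<^sub>R param_axis a, 0) = (\<Sum>a\<in>UNIV. c a * D (param_axis a, 0))"
proof -
  have "(\<Sum>a\<in>UNIV. c a *\<^sub>R param_axis a, 0) = (\<Sum>a\<in>UNIV. c a *\<^sub>R (param_axis a, 0 :: 'x))"
    by (simp add: prod_eq_iff fst_sum snd_sum)
  then show ?thesis
    by (simp only: linear_sum[OF assms] linear_scale[OF assms] real_scaleR_def)
qed

theorem theorem5p1:
  fixes f1 f2 :: "real^'n \<Rightarrow> real" and U1 U2 :: "(real^'n) set"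
    and x1 x2 :: "real^'n" and X :: "(real^'n) \<times> real"
  assumes "open U1" and "open U2"
    and "smooth_on U1 f1" and "smooth_on U2 f2"
    and "nondegenerate_graph U1 f1" and "nondegenerate_graph U2 f2"
    and "locally_convex_graph U1 f1" and "locally_convex_graph U2 f2"
    and "\<forall>x\<in>U1. \<forall>y\<in>U2. transversal (graph_tangent_space f1 x) (graph_tangent_space f2 y)"
    and "x1 \<in> U1" and "x2 \<in> U2"
    and "mid_normal f1 f2 (x1, x2) \<noteq> 0"
    and "emh_G f1 f2 ((x1, x2), X) = 0"
    and "emh_Delta f1 f2 (x1, x2) X \<noteq> 0"
  shows "X \<in> EMH U1 U2 f1 f2 \<and> EMH_smooth_at U1 U2 f1 f2 ((x1, x2), X)"
proof -
  define S where "S = (U1 \<times> U2) \<times> (UNIV :: ((real^'n) \<times> real) set)"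
  define F where "F z = emh_F f1 f2 (fst z) (snd z)" for z
  let ?d = "\<lambda>a. partial_deriv (param_axis a, 0) F"
  define K where "K z = (\<Sum>a\<in>UNIV. ?d a z *\<^sub>R param_axis a)" for z
  define z0 where "z0 = ((x1, x2), X)"
  have S: "open S" unfolding S_def using assms(1,2) by (intro open_Times open_UNIV)
  have z0: "z0 \<in> S" using assms(10,11) by (simp add: S_def z0_def)
  have F: "smooth_on S F"
    unfolding S_def F_def by (rule smooth_on_emh_F[OF assms(1-4)])
  have d: "smooth_on S (?d a)" for a by (rule smooth_on_partial_deriv[OF S F])
  have K: "smooth_on S K"
    unfolding K_def by (intro smooth_on_sum smooth_on_scaleR smooth_on_const S d)
  have slice: "partial_deriv (param_axis a) (\<lambda>w'. emh_F f1 f2 w' Y) w = ?d a (w, Y)" for a w Y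
    using partial_deriv_slice[of "param_axis a" F Y w] by (simp add: F_def)
  have G: "emh_G f1 f2 z = 0 \<longleftrightarrow> F z = 0 \<and> K z = 0" for z
  proof -
    obtain w Y where z: "z = (w, Y)" by (cases z)
    have "emh_G f1 f2 z = (F z, \<chi> a. ?d a z)"
      unfolding z emh_G.simps slice by (simp add: F_def)
    then have "emh_G f1 f2 z = 0 \<longleftrightarrow> F z = 0 \<and> (\<forall>a. ?d a z = 0)"
      by (simp add: prod_eq_iff vec_eq_iff)
    then show ?thesis
      by (simp only: K_def sum_param_axis_eq_0)
  qed
  have F0: "F z0 = 0" and K0: "K z0 = 0" using G[of z0] assms(13) by (simp_all add: z0_def)
  have Dd: "frechet_derivative (?d b) (at z0) (v, 0) = partial_deriv (v, 0) (?d b) z0" for b v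
    by (rule partial_deriv_frechet_derivative[OF d z0, symmetric])
  \<comment> \<open>the derivative of $K$ in $w$ is multiplication by the transpose of this matrix\<close>
  define Hess where "Hess = (\<chi> a b. partial_deriv (param_axis a, 0) (?d b) z0)"
  have "emh_Delta f1 f2 (x1, x2) X = det Hess"
    unfolding emh_Delta_def slice Hess_def z0_def by (simp only: partial_deriv_slice)
  then have inv: "invertible (transpose Hess)"
    using assms(14) by (simp add: invertible_det_nz)
  have "\<exists>W H. open W \<and> z0 \<in> W \<and>
     smooth_submanifold (DIM((real^'n) \<times> real) - 1) (W \<inter> {z \<in> S. F z = 0 \<and> K z = 0}) \<and>
     smooth_submanifold (DIM((real^'n) \<times> real) - 1) H \<and> snd z0 \<in> H \<and>
     diffeomorphism (W \<inter> {z \<in> S. F z = 0 \<and> K z = 0}) H snd"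
  proof (rule smooth_envelope[OF S K F z0 K0 F0])
    fix v :: "(real^'n) \<times> (real^'n)"
    obtain c where c: "v = (\<Sum>a\<in>UNIV. c a *\<^sub>R param_axis a)" by (rule param_axis_coordinates)
    show "frechet_derivative F (at z0) (v, 0) = 0"
    proof -
      have "frechet_derivative F (at z0) (param_axis a, 0) = 0" for a
        using K0 partial_deriv_frechet_derivative[OF F z0, of "(param_axis a, 0)"]
        by (simp add: K_def sum_param_axis_eq_0)
      then show ?thesis
        unfolding c
        by (simp add: linear_slice_param_axis[OF has_derivative_linear[OF smooth_on_has_derivative[OF F z0]]])
    qed
    assume v: "frechet_derivative K (at z0) (v, 0) = 0"
    have "(K has_derivative (\<lambda>h. \<Sum>b\<in>UNIV. frechet_derivative (?d b) (at z0) h *\<^sub>R param_axis b)) (at z0)"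
      unfolding K_def
      by (intro has_derivative_sum has_derivative_scaleR_left smooth_on_has_derivative[OF d z0])
    from fun_cong[OF frechet_derivative_at[OF this], of "(v, 0)"] v
    have "frechet_derivative (?d b) (at z0) (v, 0) = 0" for b
      by (simp add: sum_param_axis_eq_0)
    then have "(\<Sum>a\<in>UNIV. c a * Hess $ a $ b) = 0" for b
      unfolding c linear_slice_param_axis[OF has_derivative_linear[OF smooth_on_has_derivative[OF d z0]]]
      by (simp add: Hess_def Dd)
    then have "transpose Hess *v (\<chi> a. c a) = 0"
      by (simp add: vec_eq_iff matrix_vector_mult_def transpose_def mult.commute)
    then have "(\<chi> a. c a) = 0"
      using inv matrix_left_invertible_ker[of "transpose Hess"] by (auto simp: invertible_def)
    then show "v = 0" by (simp add: c sum_param_axis_eq_0 vec_eq_iff)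
  next
    define m where "m = mid_normal f1 f2 (x1, x2)"
    \<comment> \<open>$F$ is affine in $X$ with linear part $m \<bullet> X$\<close>
    have "frechet_derivative F (at z0) (0, m) = partial_deriv (0, m) F z0"
      by (rule partial_deriv_frechet_derivative[OF F z0, symmetric])
    also have "\<dots> = deriv (\<lambda>t. m \<bullet> (X + t *\<^sub>R m - mid_point f1 f2 (x1, x2))) 0"
      by (simp add: partial_deriv_def F_def z0_def emh_F_def m_def del: mid_normal.simps mid_point.simps)
    also have "\<dots> = m \<bullet> m"
      by (rule DERIV_imp_deriv) (auto intro!: derivative_eq_intros simp: inner_diff_right inner_add_right)
    finally have "frechet_derivative F (at z0) (0, m) = m \<bullet> m" .
    moreover have "m \<bullet> m \<noteq> 0" using assms(12) by (simp add: m_def del: mid_normal.simps)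
    ultimately show "\<exists>x. frechet_derivative F (at z0) (0, x) \<noteq> 0" by (intro exI[of _ m]) simp
  qed
  moreover have "{z \<in> S. F z = 0 \<and> K z = 0} = emh_zero_set U1 U2 f1 f2"
    by (simp add: emh_zero_set_def S_def G)
  ultimately have "EMH_smooth_at U1 U2 f1 f2 z0"
    unfolding EMH_smooth_at_def by simp
  moreover have "z0 \<in> emh_zero_set U1 U2 f1 f2"
    using z0 F0 K0 G[of z0] by (simp add: emh_zero_set_def S_def)
  then have "X \<in> EMH U1 U2 f1 f2"
    unfolding EMH_def z0_def by force
  ultimately show ?thesis by (simp add: z0_def)
qed

end
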